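(* Let $X,Y$ be complex Banach spaces. For every $N\in\mathbb{N}$ there exists $\delta_N\in(0,1)$, with $\delta_N\to0$ as $N\to\infty$, such that for every $s\in(0,1]$ and every $P\in\mathcal{P}(^NX;Y)$, $$\|P\|_v=\frac{\delta_N}{s^N}\|P\|_s.$$ Moreover, for $P\in\mathcal{P}(^NX;Y)$ the following statements are equivalent: (a) $P$ attains the $v$-norm. (b) $P$ attains the $s$-norm for some $s\in(0,1]$. (c) $P$ attains the $s$-norm for every $s\in(0,1]$.
   Context: $\mathbb{N}=\{1,2,\dots\}$. $B_X$ is the open unit ball of $X$ and $\overline{B_X}$ the closed unit ball. $\mathcal{P}(^NX;Y)$ is the space of continuous $N$-homogeneous polynomials $P:X\to Y$, i.e. $P(x)=A(x,\dots,x)$ with $A$ a continuous symmetric $N$-linear map. For $s\in(0,1]$, $\|P\|_s=\sup_{x\in B_X}\|P(sx)\|$, and $\|P\|_v=\sup_{x\in B_X}(1-\|x\|^2)\|P(x)\|$. $P$ attains the $s$-norm if there is $x_0\in s\overline{B_X}$ with $\|P\|_s=\|P(x_0)\|$; $P$ attains the $v$-norm if there is $x_0\in\overline{B_X}$ with $\|P\|_v=(1-\|x_0\|^2)\|P(x_0)\|$. *)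

theory Defs
  imports "HOL-Analysis.Analysis" "HOL-Combinatorics.Permutations"
begin

class complex_banach = banach +
  fixes scaleC :: "complex \<Rightarrow> 'a \<Rightarrow> 'a"  (infixr "*\<^sub>C" 75)
  assumes scaleC_add_right: "a *\<^sub>C (x + y) = a *\<^sub>C x + a *\<^sub>C y"
    and scaleC_add_left: "(a + b) *\<^sub>C x = a *\<^sub>C x + b *\<^sub>C x"
    and scaleC_scaleC: "a *\<^sub>C (b *\<^sub>C x) = (a * b) *\<^sub>C x"
    and scaleC_of_real: "complex_of_real r *\<^sub>C x = r *\<^sub>R x"
    and norm_scaleC: "norm (a *\<^sub>C x) = cmod a * norm x"

lemma scaleC_one: "1 *\<^sub>C x = (x :: 'a::complex_banach)"
  using scaleC_of_real[of 1 x] by simp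

lemma vector_space_scaleC: "vector_space (scaleC :: complex \<Rightarrow> 'a::complex_banach \<Rightarrow> 'a)"
  by unfold_locales (simp_all add: scaleC_add_right scaleC_add_left scaleC_scaleC scaleC_one)

instantiation complex :: complex_banach
begin

definition scaleC_complex :: "complex \<Rightarrow> complex \<Rightarrow> complex" where
  "scaleC_complex a x = a * x"

instance
  by standard (simp_all add: scaleC_complex_def algebra_simps norm_mult scaleR_conv_of_real)

end

text \<open>The power \<open>X\<^sup>N\<close> is the set \<open>\<Pi>\<^sub>E i\<in>{..<N}. UNIV\<close> of extensional functions, the carrier of
  the product topology below. The values of \<open>A\<close> off this set play no role.\<close>

definition symmetric_multilinear :: "nat \<Rightarrow> ((nat \<Rightarrow> 'a::complex_banach) \<Rightarrow> 'b::complex_banach) \<Rightarrow> bool" where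
  "symmetric_multilinear N A \<longleftrightarrow>
     (\<forall>x \<in> (\<Pi>\<^sub>E i\<in>{..<N}. UNIV). \<forall>i<N. Vector_Spaces.linear scaleC scaleC (\<lambda>u. A (x(i := u)))) \<and>
     (\<forall>x \<in> (\<Pi>\<^sub>E i\<in>{..<N}. UNIV). \<forall>\<sigma>. \<sigma> permutes {..<N} \<longrightarrow> A (x \<circ> \<sigma>) = A x)"

definition hom_poly :: "nat \<Rightarrow> ('a::complex_banach \<Rightarrow> 'b::complex_banach) set" where
  "hom_poly N = {P. \<exists>A. symmetric_multilinear N A \<and>
     continuous_map (product_topology (\<lambda>_. euclidean) {..<N}) euclidean A \<and>
     (\<forall>x. P x = A (\<lambda>i\<in>{..<N}. x))}"

definition s_norm :: "real \<Rightarrow> ('a::complex_banach \<Rightarrow> 'b::complex_banach) \<Rightarrow> real" where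
  "s_norm s P = (SUP x\<in>ball 0 1. norm (P (s *\<^sub>R x)))"

definition v_norm :: "('a::complex_banach \<Rightarrow> 'b::complex_banach) \<Rightarrow> real" where
  "v_norm P = (SUP x\<in>ball 0 1. (1 - (norm x)\<^sup>2) * norm (P x))"

definition attains_s_norm :: "real \<Rightarrow> ('a::complex_banach \<Rightarrow> 'b::complex_banach) \<Rightarrow> bool" where
  "attains_s_norm s P \<longleftrightarrow> (\<exists>x\<^sub>0 \<in> (\<lambda>x. s *\<^sub>R x) ` cball 0 1. s_norm s P = norm (P x\<^sub>0))"

definition attains_v_norm :: "('a::complex_banach \<Rightarrow> 'b::complex_banach) \<Rightarrow> bool" where
  "attains_v_norm P \<longleftrightarrow> (\<exists>x\<^sub>0 \<in> cball 0 1. v_norm P = (1 - (norm x\<^sub>0)\<^sup>2) * norm (P x\<^sub>0))"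

end

theory Submission
  imports Defs
begin

text \<open>Restricting \<open>P\<close> to a ray turns the weight \<open>1 - \<parallel>x\<parallel>\<^sup>2\<close> into the function
  \<open>(1 - t\<^sup>2) t\<^sup>N\<close> of \<open>t = \<parallel>x\<parallel>\<close>, so \<open>\<delta>\<^sub>N\<close> is the maximum of this function on \<open>[0,1]\<close>.
  Any maximiser lies in \<open>(0,1)\<close>; rescaling a point to norm a maximiser, respectively to norm
  one, exchanges points where the \<open>v\<close>-norm and the \<open>s\<close>-norms are attained.\<close>

section \<open>The maximum of the radial weight\<close>

definition radial_max :: "nat \<Rightarrow> real" where
  "radial_max N = (SUP t\<in>{0..1}. (1 - t\<^sup>2) * t ^ N)"

text \<open>Compactness of the interval gives a maximiser. It is interior because the function is
  positive at \<open>1/2\<close> and vanishes at both endpoints, at \<open>0\<close> because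
  \<open>N \<ge> 1\<close>.\<close>

lemma radial_max_attained:
  assumes "N \<ge> 1"
  obtains t where "0 < t" "t < 1" "radial_max N = (1 - t\<^sup>2) * t ^ N"
    and "\<And>u. 0 \<le> u \<Longrightarrow> u \<le> 1 \<Longrightarrow> (1 - u\<^sup>2) * u ^ N \<le> radial_max N"
proof -
  let ?f = "\<lambda>t::real. (1 - t\<^sup>2) * t ^ N"
  have "continuous_on {0..1} ?f"
    by (intro continuous_intros)
  then obtain t where t: "t \<in> {0..1}" and max: "\<forall>u\<in>{0..1}. ?f u \<le> ?f t"
    using continuous_attains_sup[of "{0..1}" ?f] by auto
  have "0 < ?f (1/2)"
    by (simp add: power2_eq_square)
  also have "\<dots> \<le> ?f t"
    using max by auto
  finally have "0 < ?f t" .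
  then have "t \<noteq> 0" "t \<noteq> 1"
    using assms by (auto simp: zero_power)
  moreover have "radial_max N = ?f t"
    unfolding radial_max_def using t max by (intro cSup_eq_maximum) auto
  ultimately show thesis
    using t max by (intro that[of t]) auto
qed

lemma radial_max_bounds:
  assumes "N \<ge> 1"
  shows "0 < radial_max N" "radial_max N < 1"
proof -
  obtain t where t: "0 < t" "t < 1" "radial_max N = (1 - t\<^sup>2) * t ^ N"
    using radial_max_attained[OF assms] by metis
  have "t\<^sup>2 < 1"
    using t by (simp add: power_less_one_iff)
  then show "0 < radial_max N"
    using t by simp
  have "(1 - t\<^sup>2) * t ^ N \<le> (1 - t\<^sup>2) * 1"
    using t \<open>t\<^sup>2 < 1\<close> by (intro mult_left_mono) (auto simp: power_le_one)
  then show "radial_max N < 1"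
    using t by (smt (verit) zero_less_power)
qed

text \<open>Factor \<open>1 - t\<^sup>2\<close> as \<open>(1 + t) * (1 - t)\<close>. The first
  factor is at most \<open>2\<close>, and the second is absorbed by the geometric sum, whose
  \<open>N\<close> terms are all at least \<open>t ^ N\<close>.\<close>

lemma radial_max_le:
  assumes "N \<ge> 1"
  shows "radial_max N \<le> 2 / real N"
proof -
  obtain t where t: "0 < t" "t < 1" "radial_max N = (1 - t\<^sup>2) * t ^ N"
    using radial_max_attained[OF assms] by metis
  have "(\<Sum>k<N. t ^ N) \<le> (\<Sum>k<N. t ^ k)"
    using t by (intro sum_mono power_decreasing) auto
  then have "(1 - t) * (real N * t ^ N) \<le> (1 - t) * (\<Sum>k<N. t ^ k)"
    using t by (intro mult_left_mono) auto
  also have "\<dots> = 1 - t ^ N"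
    by (simp add: one_diff_power_eq)
  finally have *: "(1 - t) * (real N * t ^ N) \<le> 1"
    using t by (smt (verit) zero_less_power)
  have "real N * radial_max N = (1 + t) * ((1 - t) * (real N * t ^ N))"
    unfolding t(3) by (simp add: power2_eq_square algebra_simps)
  also have "\<dots> \<le> 2 * 1"
    using t * by (intro mult_mono) auto
  finally show ?thesis
    using assms by (simp add: field_simps)
qed

lemma radial_max_tendsto_0: "radial_max \<longlonglongrightarrow> 0"
proof (rule tendsto_sandwich)
  show "\<forall>\<^sub>F N in sequentially. 0 \<le> radial_max N"
    using radial_max_bounds(1) by (intro eventually_sequentiallyI[of 1]) (auto intro: less_imp_le)
  show "\<forall>\<^sub>F N in sequentially. radial_max N \<le> 2 / real N"
    using radial_max_le by (intro eventually_sequentiallyI[of 1])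
  show "(\<lambda>N. 2 / real N) \<longlonglongrightarrow> 0"
    by (rule lim_const_over_n)
qed auto

section \<open>Homogeneity, continuity and boundedness of polynomials\<close>

lemma hom_poly_scaleC:
  assumes "P \<in> hom_poly N"
  shows "P (a *\<^sub>C x) = (a ^ N) *\<^sub>C P x"
proof -
  obtain A where A: "symmetric_multilinear N A" and P: "\<And>x. P x = A (\<lambda>i\<in>{..<N}. x)"
    using assms unfolding hom_poly_def by blast
  \<comment> \<open>The slots are scaled one at a time: \<open>f k\<close> and
    \<open>f (Suc k)\<close> differ in slot \<open>k\<close> only, where linearity of
    \<open>A\<close> releases one factor \<open>a\<close>.\<close>
  define f where "f k = (\<lambda>i\<in>{..<N}. if i < k then a *\<^sub>C x else x)" for k
  have "k \<le> N \<Longrightarrow> A (f k) = (a ^ k) *\<^sub>C A (f 0)" for k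
  proof (induction k)
    case 0
    then show ?case by (simp add: scaleC_one)
  next
    case (Suc k)
    have "f k \<in> (\<Pi>\<^sub>E i\<in>{..<N}. UNIV)"
      by (simp add: f_def)
    then interpret L: Vector_Spaces.linear scaleC scaleC "\<lambda>u. A ((f k)(k := u))"
      using A Suc.prems unfolding symmetric_multilinear_def by auto
    have "f (Suc k) = (f k)(k := a *\<^sub>C x)" "(f k)(k := x) = f k"
      using Suc.prems by (auto simp: f_def fun_eq_iff)
    then have "A (f (Suc k)) = a *\<^sub>C A (f k)"
      using L.scale[of a x] by simp
    then show ?case
      using Suc by (simp add: scaleC_scaleC)
  qed
  from this[of N] have "A (f N) = (a ^ N) *\<^sub>C A (f 0)"
    by simp
  moreover have "f N = (\<lambda>i\<in>{..<N}. a *\<^sub>C x)" "f 0 = (\<lambda>i\<in>{..<N}. x)"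
    by (auto simp: f_def fun_eq_iff)
  ultimately show ?thesis
    by (simp add: P)
qed

lemma hom_poly_scaleR:
  assumes "P \<in> hom_poly N"
  shows "P (r *\<^sub>R x) = (r ^ N) *\<^sub>R P x"
  using hom_poly_scaleC[OF assms, of "complex_of_real r" x]
  by (simp add: scaleC_of_real flip: of_real_power)

lemma norm_hom_poly_scaleR:
  assumes "P \<in> hom_poly N" "r \<ge> 0"
  shows "norm (P (r *\<^sub>R x)) = r ^ N * norm (P x)"
  using assms by (simp add: hom_poly_scaleR)

lemma hom_poly_0:
  assumes "P \<in> hom_poly N" "N \<ge> 1"
  shows "P 0 = 0"
  using hom_poly_scaleR[OF assms(1), of 0 0] assms(2) by (simp add: zero_power)

text \<open>\<open>P\<close> is \<open>A\<close> after the diagonal embedding, which is continuous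
  because each of its components is the identity.\<close>

lemma continuous_on_hom_poly:
  assumes "P \<in> hom_poly N"
  shows "continuous_on UNIV P"
proof -
  obtain A where "continuous_map (product_topology (\<lambda>_. euclidean) {..<N}) euclidean A"
    and P: "\<And>x. P x = A (\<lambda>i\<in>{..<N}. x)"
    using assms unfolding hom_poly_def by blast
  moreover have "continuous_map euclidean (product_topology (\<lambda>_. euclidean) {..<N})
      (\<lambda>x::'a. \<lambda>i\<in>{..<N}. x)"
    by (auto simp: continuous_map_componentwise)
  ultimately have "continuous_map euclidean euclidean (A \<circ> (\<lambda>x. \<lambda>i\<in>{..<N}. x))"
    using continuous_map_compose by blast
  then show ?thesis
    by (simp add: P comp_def)
qed

text \<open>Continuity at \<open>0\<close> bounds \<open>P\<close> on a small ball, and homogeneity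
  carries the bound to the unit ball. Real suprema are meaningful only over bounded sets, so the
  norms rest on this bound.\<close>

lemma hom_poly_bounded:
  assumes "P \<in> hom_poly N" "N \<ge> 1"
  obtains M where "\<And>x. norm x \<le> 1 \<Longrightarrow> norm (P x) \<le> M"
proof -
  have "isCont P 0"
    using continuous_on_hom_poly[OF assms(1)] continuous_on_eq_continuous_at by blast
  then obtain d where d: "d > 0" "\<And>x. norm x < d \<Longrightarrow> norm (P x) < 1"
    unfolding continuous_at_eps_delta hom_poly_0[OF assms]
    by (metis dist_norm diff_zero zero_less_one)
  \<comment> \<open>Scaling by \<open>d/2\<close> instead of \<open>d\<close> keeps the closed unit
    ball strictly inside radius \<open>d\<close>.\<close>
  have "norm (P x) \<le> 1 / (d/2) ^ N" if "norm x \<le> 1" for x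
  proof -
    have "d / 2 * norm x \<le> d / 2 * 1"
      using that d(1) by (intro mult_left_mono) auto
    then have "norm ((d/2) *\<^sub>R x) < d"
      using d(1) by simp
    then have "(d/2) ^ N * norm (P x) < 1"
      using d norm_hom_poly_scaleR[OF assms(1), of "d/2" x] by fastforce
    then show ?thesis
      using d(1) by (simp add: pos_le_divide_eq mult.commute)
  qed
  then show thesis
    using that by blast
qed

section \<open>The norms as multiples of the \<open>s\<close>-norm for \<open>s = 1\<close>\<close>

lemma norm_hom_poly_le_s_norm:
  assumes "P \<in> hom_poly N" "N \<ge> 1"
  shows "norm (P x) \<le> s_norm 1 P * norm x ^ N"
proof (cases "x = 0")
  case True
  then show ?thesis
    using assms by (simp add: hom_poly_0 zero_power)
next
  case False
  obtain M where M: "\<And>x. norm x \<le> 1 \<Longrightarrow> norm (P x) \<le> M"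
    using hom_poly_bounded[OF assms] by blast
  then have bdd: "bdd_above ((\<lambda>x. norm (P (1 *\<^sub>R x))) ` ball 0 1)"
    by (intro bdd_aboveI[of _ M]) auto
  \<comment> \<open>The supremum runs over the open ball, so \<open>x\<close> cannot be normalised
    to norm \<open>1\<close> directly; it is scaled to norm \<open>r < 1\<close>, and then
    \<open>r\<close> tends to \<open>1\<close> from the left.\<close>
  have "(r / norm x) ^ N * norm (P x) \<le> s_norm 1 P" if "0 < r" "r < 1" for r
  proof -
    have "norm (P (1 *\<^sub>R ((r / norm x) *\<^sub>R x))) \<le> s_norm 1 P"
      unfolding s_norm_def using that False by (intro cSUP_upper bdd) auto
    then show ?thesis
      using that by (simp add: norm_hom_poly_scaleR[OF assms(1)])
  qed
  then have "\<forall>\<^sub>F r in at_left 1. (r / norm x) ^ N * norm (P x) \<le> s_norm 1 P"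
    by (intro eventually_at_leftI[of 0]) auto
  moreover have "((\<lambda>r. (r / norm x) ^ N * norm (P x)) \<longlongrightarrow> (1 / norm x) ^ N * norm (P x)) (at_left 1)"
    using False by (intro tendsto_intros) auto
  ultimately have "(1 / norm x) ^ N * norm (P x) \<le> s_norm 1 P"
    by (intro tendsto_upperbound) auto
  then show ?thesis
    using False by (simp add: power_divide field_simps)
qed

lemma s_norm_1_nonneg:
  assumes "P \<in> hom_poly N" "N \<ge> 1"
  shows "0 \<le> s_norm 1 P"
proof -
  obtain M where "\<And>x. norm x \<le> 1 \<Longrightarrow> norm (P x) \<le> M"
    using hom_poly_bounded[OF assms] by blast
  then have "norm (P (1 *\<^sub>R 0)) \<le> s_norm 1 P"
    unfolding s_norm_def by (intro cSUP_upper bdd_aboveI[of _ M]) auto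
  then show ?thesis
    using norm_ge_zero order_trans by blast
qed

lemma s_norm_eq:
  assumes "P \<in> hom_poly N" "N \<ge> 1" "s > 0"
  shows "s_norm s P = s ^ N * s_norm 1 P"
proof (rule antisym)
  show "s_norm s P \<le> s ^ N * s_norm 1 P"
    unfolding s_norm_def[of s]
  proof (rule cSUP_least)
    fix x :: 'a assume "x \<in> ball 0 1"
    then have "s_norm 1 P * norm x ^ N \<le> s_norm 1 P * 1"
      using s_norm_1_nonneg[OF assms(1,2)] by (intro mult_left_mono power_le_one) auto
    then have "norm (P x) \<le> s_norm 1 P"
      using norm_hom_poly_le_s_norm[OF assms(1,2), of x] by simp
    then show "norm (P (s *\<^sub>R x)) \<le> s ^ N * s_norm 1 P"
      using assms by (simp add: norm_hom_poly_scaleR)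
  qed auto
  obtain M where M: "\<And>x. norm x \<le> 1 \<Longrightarrow> norm (P x) \<le> M"
    using hom_poly_bounded[OF assms(1,2)] by blast
  then have bdd: "bdd_above ((\<lambda>x. norm (P (s *\<^sub>R x))) ` ball 0 1)"
    using assms by (intro bdd_aboveI[of _ "s ^ N * M"]) (auto simp: norm_hom_poly_scaleR)
  have "s_norm 1 P \<le> s_norm s P / s ^ N"
    unfolding s_norm_def[of 1]
  proof (rule cSUP_least)
    fix x :: 'a assume "x \<in> ball 0 1"
    then have "norm (P (s *\<^sub>R x)) \<le> s_norm s P"
      unfolding s_norm_def[of s] by (intro cSUP_upper bdd)
    then show "norm (P (1 *\<^sub>R x)) \<le> s_norm s P / s ^ N"
      using assms by (simp add: norm_hom_poly_scaleR field_simps)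
  qed auto
  then show "s ^ N * s_norm 1 P \<le> s_norm s P"
    using assms(3) by (simp add: field_simps)
qed

text \<open>The two links of the chain are stated separately so that equality of its ends, which is
  attainment of the \<open>v\<close>-norm, forces equality in the first link.\<close>

lemma weighted_norm_hom_poly_le:
  assumes "P \<in> hom_poly N" "N \<ge> 1" "norm x \<le> 1"
  shows "(1 - (norm x)\<^sup>2) * norm (P x) \<le> (1 - (norm x)\<^sup>2) * norm x ^ N * s_norm 1 P"
    and "(1 - (norm x)\<^sup>2) * norm x ^ N * s_norm 1 P \<le> radial_max N * s_norm 1 P"
proof -
  have "0 \<le> 1 - (norm x)\<^sup>2"
    using assms(3) by (simp add: power_le_one)
  then show "(1 - (norm x)\<^sup>2) * norm (P x) \<le> (1 - (norm x)\<^sup>2) * norm x ^ N * s_norm 1 P"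
    unfolding mult.assoc using norm_hom_poly_le_s_norm[OF assms(1,2), of x]
    by (intro mult_left_mono) (simp_all add: mult.commute)
  have "(1 - (norm x)\<^sup>2) * norm x ^ N \<le> radial_max N"
    using radial_max_attained[OF assms(2)] assms(3) by (metis norm_ge_zero)
  then show "(1 - (norm x)\<^sup>2) * norm x ^ N * s_norm 1 P \<le> radial_max N * s_norm 1 P"
    using s_norm_1_nonneg[OF assms(1,2)] by (rule mult_right_mono)
qed

lemma v_norm_eq:
  assumes "P \<in> hom_poly N" "N \<ge> 1"
  shows "v_norm P = radial_max N * s_norm 1 P"
proof (rule antisym)
  have le: "(1 - (norm x)\<^sup>2) * norm (P x) \<le> radial_max N * s_norm 1 P" if "x \<in> ball 0 1" for x
    using weighted_norm_hom_poly_le[OF assms, of x] that by simp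
  then show "v_norm P \<le> radial_max N * s_norm 1 P"
    unfolding v_norm_def by (intro cSUP_least) auto
  have upper: "(1 - (norm x)\<^sup>2) * norm (P x) \<le> v_norm P" if "x \<in> ball 0 1" for x
    unfolding v_norm_def using that le by (intro cSUP_upper bdd_aboveI2) auto
  obtain t where t: "0 < t" "t < 1" "radial_max N = (1 - t\<^sup>2) * t ^ N"
    using radial_max_attained[OF assms(2)] by metis
  have pos: "0 < radial_max N"
    by (rule radial_max_bounds[OF assms(2)])
  have "s_norm 1 P \<le> v_norm P / radial_max N"
    unfolding s_norm_def
  proof (rule cSUP_least)
    fix x :: 'a assume x: "x \<in> ball 0 1"
    \<comment> \<open>Testing the \<open>v\<close>-norm at \<open>t *\<^sub>R x\<close> suffices:
      this point has norm at most \<open>t\<close>, so its weight is at least the one occurring in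
      \<open>radial_max N\<close>.\<close>
    have "0 \<le> 1 - (norm (t *\<^sub>R x))\<^sup>2 \<and> 1 - t\<^sup>2 \<le> 1 - (norm (t *\<^sub>R x))\<^sup>2"
      using x t by (auto simp: power_mult_distrib power_le_one mult_le_one intro!: mult_left_le)
    then have "(1 - t\<^sup>2) * (t ^ N * norm (P x)) \<le> (1 - (norm (t *\<^sub>R x))\<^sup>2) * norm (P (t *\<^sub>R x))"
      using t by (simp add: norm_hom_poly_scaleR[OF assms(1)] mult_right_mono)
    also have "\<dots> \<le> v_norm P"
      using x t mult_strict_mono[of t 1 "norm x" 1] by (intro upper) auto
    finally show "norm (P (1 *\<^sub>R x)) \<le> v_norm P / radial_max N"
      using pos t by (simp add: pos_le_divide_eq mult_ac)
  qed auto
  then show "radial_max N * s_norm 1 P \<le> v_norm P"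
    using pos by (simp add: field_simps)
qed

section \<open>Attainment of the norms\<close>

text \<open>The factor \<open>s ^ N\<close> cancels on both sides, which leaves a criterion free of
  \<open>s\<close>; this is why some \<open>s\<close> and every \<open>s\<close> amount to the
  same.\<close>

lemma attains_s_norm_iff:
  assumes "P \<in> hom_poly N" "N \<ge> 1" "s > 0"
  shows "attains_s_norm s P \<longleftrightarrow> (\<exists>x\<in>cball 0 1. norm (P x) = s_norm 1 P)"
  unfolding attains_s_norm_def s_norm_eq[OF assms] using assms
  by (auto simp: norm_hom_poly_scaleR eq_commute[of "s_norm 1 P"])

lemma attains_v_norm_iff:
  assumes "P \<in> hom_poly N" "N \<ge> 1"
  shows "attains_v_norm P \<longleftrightarrow> (\<exists>x\<in>cball 0 1. norm (P x) = s_norm 1 P)"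
proof
  assume "attains_v_norm P"
  then obtain x where x: "norm x \<le> 1"
    and eq: "radial_max N * s_norm 1 P = (1 - (norm x)\<^sup>2) * norm (P x)"
    unfolding attains_v_norm_def v_norm_eq[OF assms] by auto
  show "\<exists>x\<in>cball 0 1. norm (P x) = s_norm 1 P"
  \<comment> \<open>If the norm is zero, the given \<open>x\<close> may be \<open>0\<close> and then
    cannot be normalised; the origin serves as witness instead.\<close>
  proof (cases "s_norm 1 P = 0")
    case True
    then show ?thesis
      using hom_poly_0[OF assms] by (intro bexI[of _ 0]) auto
  next
    case False
    have "radial_max N * s_norm 1 P \<noteq> 0"
      using False radial_max_bounds[OF assms(2)] by simp
    \<comment> \<open>A nonzero \<open>v\<close>-norm is attained neither at the centre nor on the
      unit sphere, so both factors may be cancelled below.\<close>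
    then have ne: "1 - (norm x)\<^sup>2 \<noteq> 0" "x \<noteq> 0"
      using eq hom_poly_0[OF assms] by auto
    have "(1 - (norm x)\<^sup>2) * norm (P x) = (1 - (norm x)\<^sup>2) * (norm x ^ N * s_norm 1 P)"
      using weighted_norm_hom_poly_le[OF assms x] eq unfolding mult.assoc by linarith
    then have "norm (P x) = norm x ^ N * s_norm 1 P"
      using ne by simp
    then have "norm (P ((1 / norm x) *\<^sub>R x)) = s_norm 1 P"
      using ne norm_hom_poly_scaleR[OF assms(1), of "1 / norm x" x]
      by (simp add: power_divide)
    then show ?thesis
      using ne by (intro bexI[of _ "(1 / norm x) *\<^sub>R x"]) auto
  qed
next
  assume "\<exists>x\<in>cball 0 1. norm (P x) = s_norm 1 P"
  then obtain x where x: "norm x \<le> 1" "norm (P x) = s_norm 1 P"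
    by auto
  obtain t where t: "0 < t" "t < 1" "radial_max N = (1 - t\<^sup>2) * t ^ N"
    using radial_max_attained[OF assms(2)] by metis
  have tx: "norm (t *\<^sub>R x) \<le> 1"
    using x t by (simp add: mult_le_one)
  \<comment> \<open>As \<open>x\<close> may have norm below \<open>1\<close>, the weight at
    \<open>t *\<^sub>R x\<close> is only bounded from below; the upper estimate of the chain then
    gives equality.\<close>
  have "1 - t\<^sup>2 \<le> 1 - (norm (t *\<^sub>R x))\<^sup>2"
    using x t by (auto simp: power_mult_distrib power_le_one intro!: mult_left_le)
  then have "radial_max N * s_norm 1 P \<le> (1 - (norm (t *\<^sub>R x))\<^sup>2) * norm (P (t *\<^sub>R x))"
    using t x s_norm_1_nonneg[OF assms]
    by (simp add: norm_hom_poly_scaleR[OF assms(1)] mult_right_mono)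
  then have "v_norm P = (1 - (norm (t *\<^sub>R x))\<^sup>2) * norm (P (t *\<^sub>R x))"
    using weighted_norm_hom_poly_le[OF assms tx] v_norm_eq[OF assms] by linarith
  then show "attains_v_norm P"
    unfolding attains_v_norm_def using tx by (intro bexI[of _ "t *\<^sub>R x"]) auto
qed

theorem proposition2p4:
  shows "(\<exists>\<delta> :: nat \<Rightarrow> real.
            (\<forall>N\<ge>1. 0 < \<delta> N \<and> \<delta> N < 1) \<and> \<delta> \<longlonglongrightarrow> 0 \<and>
            (\<forall>N\<ge>1. \<forall>s\<in>{0<..1}. \<forall>P :: 'a::complex_banach \<Rightarrow> 'b::complex_banach.
               P \<in> hom_poly N \<longrightarrow> v_norm P = \<delta> N / s ^ N * s_norm s P)) \<and>
         (\<forall>N\<ge>1. \<forall>P :: 'a \<Rightarrow> 'b. P \<in> hom_poly N \<longrightarrow>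
            (attains_v_norm P \<longleftrightarrow> (\<exists>s\<in>{0<..1}. attains_s_norm s P)) \<and>
            ((\<exists>s\<in>{0<..1}. attains_s_norm s P) \<longleftrightarrow> (\<forall>s\<in>{0<..1}. attains_s_norm s P)))"
proof (intro conjI exI[of _ radial_max])
  show "\<forall>N\<ge>1. 0 < radial_max N \<and> radial_max N < 1"
    using radial_max_bounds by blast
  show "radial_max \<longlonglongrightarrow> 0"
    by (rule radial_max_tendsto_0)
  show "\<forall>N\<ge>1. \<forall>s\<in>{0<..1}. \<forall>P :: 'a \<Rightarrow> 'b.
      P \<in> hom_poly N \<longrightarrow> v_norm P = radial_max N / s ^ N * s_norm s P"
  proof (intro allI impI ballI)
    fix N :: nat and s :: real and P :: "'a \<Rightarrow> 'b"
    assume "N \<ge> 1" "s \<in> {0<..1}" "P \<in> hom_poly N"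
    then show "v_norm P = radial_max N / s ^ N * s_norm s P"
      using v_norm_eq[of P N] s_norm_eq[of P N s] by simp
  qed
  show "\<forall>N\<ge>1. \<forall>P :: 'a \<Rightarrow> 'b. P \<in> hom_poly N \<longrightarrow>
      (attains_v_norm P \<longleftrightarrow> (\<exists>s\<in>{0<..1}. attains_s_norm s P)) \<and>
      ((\<exists>s\<in>{0<..1}. attains_s_norm s P) \<longleftrightarrow> (\<forall>s\<in>{0<..1}. attains_s_norm s P))"
  proof (intro allI impI)
    fix N :: nat and P :: "'a \<Rightarrow> 'b"
    assume N: "N \<ge> 1" and P: "P \<in> hom_poly N"
    have s: "attains_s_norm s P \<longleftrightarrow> attains_v_norm P" if "s \<in> {0<..1}" for s
      using that attains_s_norm_iff[OF P N] attains_v_norm_iff[OF P N] by simp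
    \<comment> \<open>A member of the range of \<open>s\<close> is needed to pass from every
      \<open>s\<close> to some \<open>s\<close>.\<close>
    have "(1::real) \<in> {0<..1}"
      by simp
    with s show "(attains_v_norm P \<longleftrightarrow> (\<exists>s\<in>{0<..1}. attains_s_norm s P)) \<and>
        ((\<exists>s\<in>{0<..1}. attains_s_norm s P) \<longleftrightarrow> (\<forall>s\<in>{0<..1}. attains_s_norm s P))"
      by blast
  qed
qed

end
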